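(* Suppose $\langle\mathcal P(\omega)/\mathrm{Fin},\sigma\rangle$ and $\langle\mathcal P(\omega)/\mathrm{Fin},\sigma^{-1}\rangle$ are conjugate. Then there is a nontrivial automorphism $\zeta$ of $\mathcal P(\omega)/\mathrm{Fin}$ such that $\langle\mathcal P(\omega)/\mathrm{Fin},\sigma\rangle$ and $\langle\mathcal P(\omega)/\mathrm{Fin},\zeta\rangle$ are conjugate. In particular, the Continuum Hypothesis implies that $\sigma$ is conjugate (in the automorphism group of $\mathcal P(\omega)/\mathrm{Fin}$) to a nontrivial automorphism of $\mathcal P(\omega)/\mathrm{Fin}$.
   Context: $\mathcal P(\omega)/\mathrm{Fin}$ is $\mathcal P(\omega)$ modulo finite sets, $\sigma([A])=[A+1]$. Two systems $\langle\mathbb A,\alpha\rangle,\langle\mathbb B,\beta\rangle$ (Boolean algebras with automorphisms) are conjugate if there is a Boolean isomorphism $\phi:\mathbb A\to\mathbb B$ with $\phi\circ\alpha=\beta\circ\phi$. An automorphism $\tau$ of $\mathcal P(\omega)/\mathrm{Fin}$ is trivial if there is a function $t:\omega\to\omega$ with $\tau([A])=[t[A]]$ for all $A\subseteq\omega$; otherwise it is nontrivial. *)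

theory Defs
  imports Complex_Main "HOL-Library.Countable_Set" "HOL-Library.Equipollence"
begin

definition eq_mod_fin :: "nat set \<Rightarrow> nat set \<Rightarrow> bool" where
  "eq_mod_fin A B \<longleftrightarrow> finite ((A - B) \<union> (B - A))"

lemma equivp_eq_mod_fin: "equivp eq_mod_fin"
proof (rule equivpI)
  show "reflp eq_mod_fin" by (simp add: reflp_def eq_mod_fin_def)
  show "symp eq_mod_fin" by (auto simp: symp_def eq_mod_fin_def)
  show "transp eq_mod_fin"
  proof (rule transpI)
    fix A B C
    assume "eq_mod_fin A B" "eq_mod_fin B C"
    then have "finite (((A - B) \<union> (B - A)) \<union> ((B - C) \<union> (C - B)))"
      by (simp add: eq_mod_fin_def)
    then show "eq_mod_fin A C"
      unfolding eq_mod_fin_def by (rule rev_finite_subset) blast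
  qed
qed

quotient_type pfin = "nat set" / eq_mod_fin
  morphisms rep_pfin cls
  by (rule equivp_eq_mod_fin)

instantiation pfin :: boolean_algebra
begin

lift_definition bot_pfin :: pfin is "{}" .

lift_definition top_pfin :: pfin is "UNIV" .

lift_definition inf_pfin :: "pfin \<Rightarrow> pfin \<Rightarrow> pfin" is "(\<inter>)"
proof -
  fix A B C D
  assume "eq_mod_fin A B" "eq_mod_fin C D"
  then have "finite (((A - B) \<union> (B - A)) \<union> ((C - D) \<union> (D - C)))"
    by (simp add: eq_mod_fin_def)
  then show "eq_mod_fin (A \<inter> C) (B \<inter> D)"
    unfolding eq_mod_fin_def by (rule rev_finite_subset) blast
qed

lift_definition sup_pfin :: "pfin \<Rightarrow> pfin \<Rightarrow> pfin" is "(\<union>)"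
proof -
  fix A B C D
  assume "eq_mod_fin A B" "eq_mod_fin C D"
  then have "finite (((A - B) \<union> (B - A)) \<union> ((C - D) \<union> (D - C)))"
    by (simp add: eq_mod_fin_def)
  then show "eq_mod_fin (A \<union> C) (B \<union> D)"
    unfolding eq_mod_fin_def by (rule rev_finite_subset) blast
qed

lift_definition minus_pfin :: "pfin \<Rightarrow> pfin \<Rightarrow> pfin" is "(-)"
proof -
  fix A B C D
  assume "eq_mod_fin A B" "eq_mod_fin C D"
  then have "finite (((A - B) \<union> (B - A)) \<union> ((C - D) \<union> (D - C)))"
    by (simp add: eq_mod_fin_def)
  then show "eq_mod_fin (A - C) (B - D)"
    unfolding eq_mod_fin_def by (rule rev_finite_subset) blast
qed

lift_definition uminus_pfin :: "pfin \<Rightarrow> pfin" is "uminus"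
proof -
  fix A B
  assume "eq_mod_fin A B"
  then show "eq_mod_fin (- A) (- B)"
    unfolding eq_mod_fin_def by (rule rev_finite_subset) blast
qed

lift_definition less_eq_pfin :: "pfin \<Rightarrow> pfin \<Rightarrow> bool" is "\<lambda>A B. finite (A - B)"
proof -
  fix A B C D
  assume "eq_mod_fin A B" "eq_mod_fin C D"
  then have fin: "finite (((A - B) \<union> (B - A)) \<union> ((C - D) \<union> (D - C)))" (is "finite ?F")
    by (simp add: eq_mod_fin_def)
  have "A - C \<subseteq> ?F \<union> (B - D)" "B - D \<subseteq> ?F \<union> (A - C)" by blast+
  then show "finite (A - C) = finite (B - D)"
    using fin by (meson finite_UnI finite_subset)
qed

definition less_pfin :: "pfin \<Rightarrow> pfin \<Rightarrow> bool" where
  "less_pfin x y \<longleftrightarrow> x \<le> y \<and> \<not> y \<le> x"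

instance
proof
  fix x y z :: pfin
  show "(x < y) = (x \<le> y \<and> \<not> y \<le> x)" by (simp add: less_pfin_def)
  show "x \<le> x" by transfer simp
  show "x \<le> z" if "x \<le> y" "y \<le> z"
    using that
  proof transfer
    fix A B C :: "nat set"
    assume "finite (A - B)" "finite (B - C)"
    then have "finite ((A - B) \<union> (B - C))" by simp
    then show "finite (A - C)" by (rule rev_finite_subset) blast
  qed
  show "x = y" if "x \<le> y" "y \<le> x"
    using that by transfer (simp add: eq_mod_fin_def)
  show "inf x y \<le> x" by transfer (rule finite_subset[of _ "{}"]; blast)
  show "inf x y \<le> y" by transfer (rule finite_subset[of _ "{}"]; blast)
  show "x \<le> inf y z" if "x \<le> y" "x \<le> z"
    using that by transfer (simp add: Diff_Int)
  show "x \<le> sup x y" by transfer (rule finite_subset[of _ "{}"]; blast)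
  show "y \<le> sup x y" by transfer (rule finite_subset[of _ "{}"]; blast)
  show "sup y z \<le> x" if "y \<le> x" "z \<le> x"
    using that by transfer (simp add: Un_Diff)
  show "bot \<le> x" by transfer simp
  show "x \<le> top" by transfer simp
  show "sup x (inf y z) = inf (sup x y) (sup x z)"
    by transfer (simp add: Un_Int_distrib eq_mod_fin_def)
  show "inf x (- x) = bot" by transfer (simp add: eq_mod_fin_def)
  show "sup x (- x) = top" by transfer (simp add: eq_mod_fin_def)
  show "x - y = inf x (- y)" by transfer (simp add: Diff_eq eq_mod_fin_def)
qed

end

lift_definition shift :: "pfin \<Rightarrow> pfin" is "\<lambda>A. Suc ` A"
proof -
  fix A B
  assume "eq_mod_fin A B"
  then have "finite (Suc ` ((A - B) \<union> (B - A)))"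
    by (simp add: eq_mod_fin_def)
  then show "eq_mod_fin (Suc ` A) (Suc ` B)"
    unfolding eq_mod_fin_def by (rule rev_finite_subset) blast
qed

lemma shift_cls: "shift (cls A) = cls (Suc ` A)"
  by (rule shift.abs_eq)

definition boolean_iso :: "('a::boolean_algebra \<Rightarrow> 'b::boolean_algebra) \<Rightarrow> bool" where
  "boolean_iso \<phi> \<longleftrightarrow> bij \<phi> \<and> \<phi> bot = bot \<and> \<phi> top = top \<and>
     (\<forall>x y. \<phi> (inf x y) = inf (\<phi> x) (\<phi> y)) \<and>
     (\<forall>x y. \<phi> (sup x y) = sup (\<phi> x) (\<phi> y)) \<and>
     (\<forall>x. \<phi> (- x) = - \<phi> x)"

abbreviation boolean_automorphism :: "('a::boolean_algebra \<Rightarrow> 'a) \<Rightarrow> bool" where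
  "boolean_automorphism \<equiv> boolean_iso"

definition conjugate_systems ::
    "('a::boolean_algebra \<Rightarrow> 'a) \<Rightarrow> ('b::boolean_algebra \<Rightarrow> 'b) \<Rightarrow> bool" where
  "conjugate_systems \<alpha> \<beta> \<longleftrightarrow>
     (\<exists>\<phi> :: 'a \<Rightarrow> 'b. boolean_iso \<phi> \<and> \<phi> \<circ> \<alpha> = \<beta> \<circ> \<phi>)"

definition conjugate_in_aut_group ::
    "('a::boolean_algebra \<Rightarrow> 'a) \<Rightarrow> ('a \<Rightarrow> 'a) \<Rightarrow> bool" where
  "conjugate_in_aut_group \<alpha> \<beta> \<longleftrightarrow>
     (\<exists>\<phi>. boolean_automorphism \<phi> \<and> \<beta> = \<phi> \<circ> \<alpha> \<circ> inv \<phi>)"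

definition trivial_automorphism :: "(pfin \<Rightarrow> pfin) \<Rightarrow> bool" where
  "trivial_automorphism \<tau> \<longleftrightarrow> boolean_automorphism \<tau> \<and>
     (\<exists>t :: nat \<Rightarrow> nat. \<forall>A. \<tau> (cls A) = cls (t ` A))"

definition nontrivial_automorphism :: "(pfin \<Rightarrow> pfin) \<Rightarrow> bool" where
  "nontrivial_automorphism \<tau> \<longleftrightarrow> boolean_automorphism \<tau> \<and> \<not> trivial_automorphism \<tau>"

definition continuum_hypothesis :: bool where
  "continuum_hypothesis \<longleftrightarrow> (\<forall>S :: real set. uncountable S \<longrightarrow> S \<approx> (UNIV :: real set))"

text \<open>\<open>inv shift\<close> is a genuine inverse, since \<open>shift\<close> is bijective.\<close>

lemma boolean_automorphism_shift: "boolean_automorphism shift"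
  unfolding boolean_iso_def
proof (intro conjI allI)
  show "bij shift"
  proof (rule bijI)
    show "inj shift"
    proof (rule injI)
      fix x y
      assume "shift x = shift y"
      then show "x = y"
      proof transfer
        fix A B
        assume "eq_mod_fin (Suc ` A) (Suc ` B)"
        then have "finite (Suc ` ((A - B) \<union> (B - A)))"
          by (simp add: eq_mod_fin_def image_Un image_set_diff)
        then show "eq_mod_fin A B"
          unfolding eq_mod_fin_def by (rule finite_imageD) simp
      qed
    qed
    show "surj shift"
    proof (rule surjI)
      fix x
      show "shift (cls (Suc -` rep_pfin x)) = x"
      proof -
        have "Suc ` (Suc -` A) = A - {0}" for A
          by (auto simp: image_iff) (metis Suc_pred gr0I)
        moreover have "eq_mod_fin (A - {0}) A" for A
          unfolding eq_mod_fin_def by (rule finite_subset[of _ "{0}"]) auto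
        ultimately have "eq_mod_fin (Suc ` (Suc -` rep_pfin x)) (rep_pfin x)" by simp
        then have "cls (Suc ` (Suc -` rep_pfin x)) = cls (rep_pfin x)"
          by (simp add: pfin.abs_eq_iff)
        then show ?thesis
          by (simp add: shift_cls Quotient3_abs_rep[OF Quotient3_pfin])
      qed
    qed
  qed
  fix x y
  show "shift bot = bot" by transfer (simp add: eq_mod_fin_def)
  have "UNIV - range Suc \<subseteq> {0}"
    by (auto simp: image_iff) (metis not0_implies_Suc)
  then have "eq_mod_fin (range Suc) UNIV"
    by (simp add: eq_mod_fin_def finite_subset)
  then show "shift top = top" by transfer
  show "shift (inf x y) = inf (shift x) (shift y)"
    by transfer (simp add: image_Int eq_mod_fin_def)
  show "shift (sup x y) = sup (shift x) (shift y)"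
    by transfer (simp add: image_Un eq_mod_fin_def)
  show "shift (- x) = - shift x"
  proof transfer
    fix A
    have "(Suc ` (- A) - - Suc ` A) \<union> (- Suc ` A - Suc ` (- A)) \<subseteq> {0}"
      by auto (metis ComplI image_eqI not0_implies_Suc)
    then show "eq_mod_fin (Suc ` (- A)) (- Suc ` A)"
      unfolding eq_mod_fin_def by (rule finite_subset) simp
  qed
qed

end

(*
The square of the shift acts on the even and on the odd numbers separately, as a copy of the
shift on each. Identifying P(omega)/Fin with its own square in this way, the shift becomes
(a, b) |-> (shift b, a). Conjugating it by id x phi gives (a, b) |-> (shift (phi^-1 b), phi a),
which is nontrivial as soon as phi is. So it suffices to find any nontrivial automorphism phi.

If phi conjugates the shift to its inverse, then shift o phi o shift = phi. Were phi induced by t,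
the function t(n + 1) + 1 would have to induce phi as well, yet t(n) < t(n + 1) + 1 for infinitely
many n since t cannot decrease forever; on a sparse set of such n the two images are disjoint.

Under CH, phi is built by a recursion of length omega_1 (cf. W. Rudin): a tower of coinfinite sets
A_i, increasing modulo finite sets, with coherent involutions g_i of A_i. Stage i
makes A_i almost contain X or its complement, for the i-th set X, and prevents the i-th function
from inducing phi.
*)

theory Submission
  imports Defs "HOL-Analysis.Abstract_Topology_2"
begin

section \<open>Classes modulo finite sets and Boolean isomorphisms\<close>

lemma cls_eq_iff: "cls A = cls B \<longleftrightarrow> eq_mod_fin A B"
  by (simp add: pfin.abs_eq_iff)

lemma cls_rep_pfin [simp]: "cls (rep_pfin x) = x"
  by (simp add: Quotient3_abs_rep[OF Quotient3_pfin])

lemma cls_cases: obtains A where "x = cls A"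
  by (metis cls_rep_pfin)

lemma eq_mod_fin_refl [simp]: "eq_mod_fin A A"
  by (simp add: eq_mod_fin_def)

lemma eq_mod_fin_empty_iff: "eq_mod_fin A {} \<longleftrightarrow> finite A"
  by (simp add: eq_mod_fin_def)

lemma boolean_iso_comp:
  assumes "boolean_iso \<phi>" "boolean_iso \<psi>"
  shows "boolean_iso (\<phi> \<circ> \<psi>)"
  using assms by (simp add: boolean_iso_def bij_comp)

lemma boolean_iso_inv:
  assumes "boolean_iso \<phi>"
  shows "boolean_iso (inv \<phi>)"
proof -
  have b: "bij \<phi>" using assms by (simp add: boolean_iso_def)
  have s: "\<phi> (inv \<phi> y) = y" for y
    using b by (simp add: bij_is_surj surj_f_inv_f)
  have r: "inv \<phi> (\<phi> x) = x" for x
    using b by (simp add: bij_is_inj)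
  have h: "\<phi> bot = bot" "\<phi> top = top" "\<And>x y. \<phi> (inf x y) = inf (\<phi> x) (\<phi> y)"
    "\<And>x y. \<phi> (sup x y) = sup (\<phi> x) (\<phi> y)" "\<And>x. \<phi> (- x) = - \<phi> x"
    using assms by (auto simp: boolean_iso_def)
  have eqI: "inv \<phi> y = x" if "\<phi> x = y" for x y
    using that r by blast
  have "inv \<phi> bot = bot" "inv \<phi> top = top"
    by (intro eqI h)+
  moreover have "inv \<phi> (inf x y) = inf (inv \<phi> x) (inv \<phi> y)"
    "inv \<phi> (sup x y) = sup (inv \<phi> x) (inv \<phi> y)" "inv \<phi> (- x) = - inv \<phi> x" for x y
    by (rule eqI, simp add: h s)+
  ultimately show ?thesis
    using bij_imp_bij_inv[OF b] by (simp add: boolean_iso_def)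
qed

lemma conjugate_in_aut_group_imp_conjugate_systems:
  assumes "conjugate_in_aut_group \<alpha> \<beta>"
  shows "conjugate_systems \<alpha> \<beta>"
proof -
  obtain \<phi> where p: "boolean_iso \<phi>" "\<beta> = \<phi> \<circ> \<alpha> \<circ> inv \<phi>"
    using assms by (auto simp: conjugate_in_aut_group_def)
  have "inj \<phi>" using p by (simp add: boolean_iso_def bij_is_inj)
  then have "\<phi> \<circ> \<alpha> = \<beta> \<circ> \<phi>"
    by (simp add: p(2) fun_eq_iff)
  then show ?thesis using p(1) by (auto simp: conjugate_systems_def)
qed


subsection \<open>Splitting into even and odd parts\<close>

lemma eq_mod_fin_vimage:
  assumes "inj f" "eq_mod_fin A B"
  shows "eq_mod_fin (f -` A) (f -` B)"
proof -
  have "finite (f -` ((A - B) \<union> (B - A)))"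
    using assms by (intro finite_vimageI) (auto simp: eq_mod_fin_def)
  then show ?thesis by (simp add: eq_mod_fin_def vimage_Diff)
qed

lift_definition even_part :: "pfin \<Rightarrow> pfin" is "\<lambda>A. (\<lambda>n. 2 * n) -` A"
  by (rule eq_mod_fin_vimage) (auto simp: inj_def)

lift_definition odd_part :: "pfin \<Rightarrow> pfin" is "\<lambda>A. (\<lambda>n. 2 * n + 1) -` A"
  by (rule eq_mod_fin_vimage) (auto simp: inj_def)

lift_definition interleave :: "pfin \<Rightarrow> pfin \<Rightarrow> pfin"
  is "\<lambda>A B. (\<lambda>n. 2 * n) ` A \<union> (\<lambda>n. 2 * n + 1) ` B"
proof -
  fix A B C D
  assume "eq_mod_fin A B" "eq_mod_fin C D"
  then have "finite ((\<lambda>n. 2 * n) ` ((A - B) \<union> (B - A)) \<union> (\<lambda>n. 2 * n + 1) ` ((C - D) \<union> (D - C)))"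
    by (simp add: eq_mod_fin_def)
  then show "eq_mod_fin ((\<lambda>n. 2 * n) ` A \<union> (\<lambda>n. 2 * n + 1) ` C)
      ((\<lambda>n. 2 * n) ` B \<union> (\<lambda>n. 2 * n + 1) ` D)"
    unfolding eq_mod_fin_def by (rule rev_finite_subset) blast
qed

lemma even_part_interleave [simp]: "even_part (interleave a b) = a"
proof transfer
  fix A B :: "nat set"
  have "(\<lambda>n. 2 * n) -` ((\<lambda>n. 2 * n) ` A \<union> (\<lambda>n. 2 * n + 1) ` B) = A"
    by auto presburger
  then show "eq_mod_fin ((\<lambda>n. 2 * n) -` ((\<lambda>n. 2 * n) ` A \<union> (\<lambda>n. 2 * n + 1) ` B)) A"
    by simp
qed

lemma odd_part_interleave [simp]: "odd_part (interleave a b) = b"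
proof transfer
  fix A B :: "nat set"
  have "(\<lambda>n. 2 * n + 1) -` ((\<lambda>n. 2 * n) ` A \<union> (\<lambda>n. 2 * n + 1) ` B) = B"
    by auto presburger
  then show "eq_mod_fin ((\<lambda>n. 2 * n + 1) -` ((\<lambda>n. 2 * n) ` A \<union> (\<lambda>n. 2 * n + 1) ` B)) B"
    by simp
qed

lemma interleave_parts [simp]: "interleave (even_part x) (odd_part x) = x"
proof transfer
  fix A :: "nat set"
  have "n \<in> (\<lambda>n. 2 * n) ` ((\<lambda>n. 2 * n) -` A) \<union> (\<lambda>n. 2 * n + 1) ` ((\<lambda>n. 2 * n + 1) -` A)
      \<longleftrightarrow> n \<in> A" for n
    by (cases "even n") (auto elim!: evenE oddE)
  then have "(\<lambda>n. 2 * n) ` ((\<lambda>n. 2 * n) -` A) \<union> (\<lambda>n. 2 * n + 1) ` ((\<lambda>n. 2 * n + 1) -` A) = A"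
    by blast
  then show "eq_mod_fin ((\<lambda>n. 2 * n) ` ((\<lambda>n. 2 * n) -` A) \<union>
      (\<lambda>n. 2 * n + 1) ` ((\<lambda>n. 2 * n + 1) -` A)) A"
    by simp
qed

lemma even_part_hom [simp]:
  "even_part bot = bot" "even_part top = top"
  "even_part (inf x y) = inf (even_part x) (even_part y)"
  "even_part (sup x y) = sup (even_part x) (even_part y)"
  "even_part (- x) = - even_part x"
  by (transfer, simp add: vimage_Compl)+

lemma odd_part_hom [simp]:
  "odd_part bot = bot" "odd_part top = top"
  "odd_part (inf x y) = inf (odd_part x) (odd_part y)"
  "odd_part (sup x y) = sup (odd_part x) (odd_part y)"
  "odd_part (- x) = - odd_part x"
  by (transfer, simp add: vimage_Compl)+

lemma pfin_eq_iff_parts: "x = y \<longleftrightarrow> even_part x = even_part y \<and> odd_part x = odd_part y"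
  by (metis interleave_parts)

lemma boolean_iso_on_odd_part:
  assumes "boolean_iso \<phi>"
  shows "boolean_iso (\<lambda>x. interleave (even_part x) (\<phi> (odd_part x)))" (is "boolean_iso ?\<eta>")
proof -
  have b: "bij \<phi>" and h: "\<phi> bot = bot" "\<phi> top = top" "\<And>x y. \<phi> (inf x y) = inf (\<phi> x) (\<phi> y)"
    "\<And>x y. \<phi> (sup x y) = sup (\<phi> x) (\<phi> y)" "\<And>x. \<phi> (- x) = - \<phi> x"
    using assms by (auto simp: boolean_iso_def)
  have "bij ?\<eta>"
  proof (rule o_bij)
    show "(\<lambda>x. interleave (even_part x) (inv \<phi> (odd_part x))) \<circ> ?\<eta> = id"
      using b by (simp add: fun_eq_iff bij_is_inj)
    show "?\<eta> \<circ> (\<lambda>x. interleave (even_part x) (inv \<phi> (odd_part x))) = id"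
      using b by (simp add: fun_eq_iff bij_is_surj surj_f_inv_f)
  qed
  then show ?thesis
    by (simp add: boolean_iso_def h pfin_eq_iff_parts)
qed

text \<open>\<open>Suc\<close> sends \<open>2 * n\<close> to \<open>2 * n + 1\<close> and
  \<open>2 * n + 1\<close> to \<open>2 * Suc n\<close>, so the halves swap and only the former odd
  half is moved up by one.\<close>

lemma shift_interleave: "shift (interleave a b) = interleave (shift b) a"
proof transfer
  fix A B :: "nat set"
  have "Suc ` ((\<lambda>n. 2 * n) ` A \<union> (\<lambda>n. 2 * n + 1) ` B) =
      (\<lambda>n. 2 * n) ` (Suc ` B) \<union> (\<lambda>n. 2 * n + 1) ` A"
    by (simp add: image_Un image_image Un_commute)
  then show "eq_mod_fin (Suc ` ((\<lambda>n. 2 * n) ` A \<union> (\<lambda>n. 2 * n + 1) ` B))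
      ((\<lambda>n. 2 * n) ` (Suc ` B) \<union> (\<lambda>n. 2 * n + 1) ` A)"
    by simp
qed

text \<open>The conjugate carries the even half to the odd half by \<open>\<phi>\<close>, so a
  function inducing it would, read on even arguments, induce \<open>\<phi>\<close> itself.\<close>

lemma shift_conjugate_nontrivial:
  assumes "nontrivial_automorphism \<phi>"
  shows "\<exists>\<zeta>. nontrivial_automorphism \<zeta> \<and> conjugate_in_aut_group shift \<zeta>"
proof -
  have iso: "boolean_iso \<phi>" using assms by (simp add: nontrivial_automorphism_def)
  define \<eta> where "\<eta> x = interleave (even_part x) (\<phi> (odd_part x))" for x
  define \<zeta> where "\<zeta> = \<eta> \<circ> shift \<circ> inv \<eta>"
  have \<eta>: "boolean_iso \<eta>"
    unfolding \<eta>_def by (rule boolean_iso_on_odd_part[OF iso])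
  have \<zeta>: "boolean_iso \<zeta>"
    unfolding \<zeta>_def by (intro boolean_iso_comp boolean_iso_inv \<eta> boolean_automorphism_shift)
  have bot: "\<phi> bot = bot" "shift bot = bot"
    using iso boolean_automorphism_shift by (auto simp: boolean_iso_def)
  have on_even: "\<zeta> (interleave a bot) = interleave bot (\<phi> a)" for a
  proof -
    have "\<eta> (interleave a bot) = interleave a bot" by (simp add: \<eta>_def bot)
    moreover have "inj \<eta>" using \<eta> by (simp add: boolean_iso_def bij_is_inj)
    ultimately have "inv \<eta> (interleave a bot) = interleave a bot" by (metis inv_f_f)
    then show ?thesis by (simp add: \<zeta>_def \<eta>_def shift_interleave bot)
  qed
  have "\<not> trivial_automorphism \<zeta>"
  proof
    assume "trivial_automorphism \<zeta>"
    then obtain t where t: "\<zeta> (cls A) = cls (t ` A)" for A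
      by (auto simp: trivial_automorphism_def)
    have "\<phi> (cls A) = cls ((\<lambda>n. t (2 * n) div 2) ` A)" for A
    proof -
      let ?T = "t ` (\<lambda>n. 2 * n) ` A"
      have "cls ((\<lambda>n. 2 * n) ` A) = interleave (cls A) bot"
        by (simp add: interleave.abs_eq bot_pfin.abs_eq)
      then have T: "cls ?T = interleave bot (\<phi> (cls A))"
        by (metis t on_even)
      have "even_part (cls ?T) = bot" "odd_part (cls ?T) = \<phi> (cls A)"
        by (simp_all add: T)
      then have fin: "finite ((\<lambda>n. 2 * n) -` ?T)"
        and eq: "\<phi> (cls A) = cls ((\<lambda>n. 2 * n + 1) -` ?T)"
        by (simp_all add: even_part.abs_eq odd_part.abs_eq bot_pfin_def cls_eq_iff
            eq_mod_fin_empty_iff)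
      \<comment> \<open>Division by two reads an odd element \<open>2 * m + 1\<close> of
        \<open>?T\<close> as \<open>m\<close>. An even element may produce a spurious
        \<open>m\<close>, but by \<open>fin\<close> there are only finitely many of these.\<close>
      have "(\<lambda>n. t (2 * n) div 2) ` A \<subseteq> ((\<lambda>n. 2 * n + 1) -` ?T) \<union> ((\<lambda>n. 2 * n) -` ?T)"
      proof clarsimp
        fix n assume "n \<in> A"  "2 * (t (2 * n) div 2) \<notin> ?T"
        then show "Suc (2 * (t (2 * n) div 2)) \<in> ?T"
          by (metis dvd_mult_div_cancel image_eqI odd_two_times_div_two_succ Suc_eq_plus1)
      qed
      moreover have "((\<lambda>n. 2 * n + 1) -` ?T) \<subseteq> (\<lambda>n. t (2 * n) div 2) ` A"
        by (auto simp: image_iff) (metis even_Suc_div_two even_mult_iff even_numeral nonzero_mult_div_cancel_left zero_neq_numeral)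
      ultimately show ?thesis
        unfolding eq cls_eq_iff eq_mod_fin_def
        by (intro finite_subset[OF _ fin]) blast
    qed
    with iso have "trivial_automorphism \<phi>" by (auto simp: trivial_automorphism_def)
    with assms show False by (simp add: nontrivial_automorphism_def)
  qed
  with \<zeta> \<eta> show ?thesis
    unfolding nontrivial_automorphism_def conjugate_in_aut_group_def \<zeta>_def by blast
qed


subsection \<open>Automorphisms conjugating the shift to its inverse\<close>

text \<open>The set has a finite image under \<open>t\<close>, so its class is sent to
  \<open>bot\<close>; injectivity of \<open>\<phi>\<close> makes the class itself
  \<open>bot\<close>.\<close>

lemma trivial_automorphism_finite_to_one:
  assumes "boolean_iso \<phi>" and t: "\<And>A. \<phi> (cls A) = cls (t ` A)"
  shows "finite {n. t n \<le> c}"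
proof -
  let ?S = "{n. t n \<le> c}"
  have "finite (t ` ?S)" by (rule finite_subset[of _ "{..c}"]) auto
  then have "\<phi> (cls ?S) = bot"
    by (simp add: t bot_pfin_def cls_eq_iff eq_mod_fin_empty_iff)
  then have "cls ?S = bot"
    using assms(1) by (metis boolean_iso_def bij_is_inj injD)
  then show ?thesis by (simp add: bot_pfin_def cls_eq_iff eq_mod_fin_empty_iff)
qed

lemma shift_reversal_nontrivial:
  assumes iso: "boolean_iso \<phi>" and conj: "\<phi> \<circ> shift = inv shift \<circ> \<phi>"
  shows "nontrivial_automorphism \<phi>"
  unfolding nontrivial_automorphism_def
proof (intro conjI iso notI)
  assume "trivial_automorphism \<phi>"
  then obtain t where t: "\<phi> (cls A) = cls (t ` A)" for A
    by (auto simp: trivial_automorphism_def)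
  define u where "u n = Suc (t (Suc n))" for n
  have fin: "finite {n. t n \<le> c}" for c
    using trivial_automorphism_finite_to_one[OF iso t] .
  \<comment> \<open>Applying the shift to \<open>conj\<close> gives
    \<open>shift \<circ> \<phi> \<circ> shift = \<phi>\<close>, and the left side is induced by
    \<open>u\<close>.\<close>
  have ut: "eq_mod_fin (u ` A) (t ` A)" for A
  proof -
    have "surj shift" using boolean_automorphism_shift by (simp add: boolean_iso_def bij_is_surj)
    then have "shift (\<phi> (shift x)) = \<phi> x" for x
      using fun_cong[OF conj, of x] by (simp add: surj_f_inv_f)
    then have "cls (Suc ` t ` Suc ` A) = cls (t ` A)"
      by (metis t shift_cls)
    then show ?thesis by (simp add: cls_eq_iff u_def image_image)
  qed
  have inf: "infinite {n. t n < u n}"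
  proof
    assume "finite {n. t n < u n}"
    then obtain N where N: "\<And>n. n \<ge> N \<Longrightarrow> \<not> t n < u n"
      by (metis finite_nat_set_iff_bounded mem_Collect_eq not_le)
    \<comment> \<open>Beyond \<open>N\<close>, \<open>u n \<le> t n\<close> means
      \<open>t (Suc n) < t n\<close>; the choice \<open>k = Suc (t N)\<close> then exceeds what
      \<open>t N\<close> can lose.\<close>
    have "t (N + k) + k \<le> t N" for k
    proof (induction k)
      case (Suc k)
      then show ?case using N[of "N + k"] by (simp add: u_def)
    qed simp
    from this[of "Suc (t N)"] show False by simp
  qed
  \<comment> \<open>Since only finitely many \<open>n\<close> have \<open>t n \<le> u m\<close>, the
    points can be chosen so sparse that \<open>t (w 0) < u (w 0) < t (w 1) < u (w 1) < ...\<close>;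
    hence no value of \<open>t\<close> on \<open>range w\<close> is a value of \<open>u\<close>
    there.\<close>
  have "\<exists>w. \<forall>k. t (w k) < u (w k) \<and> u (w k) < t (w (Suc k))"
  proof (rule dependent_nat_choice)
    show "\<exists>n. t n < u n" using inf by (metis (mono_tags) Collect_empty_eq finite.emptyI)
    fix m :: nat
    have "infinite ({n. t n < u n} - {n. t n \<le> u m})"
      using inf fin by (rule Diff_infinite_finite[rotated])
    then show "\<exists>n. t n < u n \<and> u m < t n"
      by (metis (no_types, lifting) Diff_iff all_not_in_conv finite.emptyI linorder_not_le mem_Collect_eq)
  qed
  then obtain w where w: "\<And>k. t (w k) < u (w k)" "\<And>k. u (w k) < t (w (Suc k))"
    by blast
  have sm: "strict_mono (\<lambda>k. t (w k))"
    using w by (auto simp: strict_mono_Suc_iff intro: less_trans)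
  have "t (w j) \<noteq> u (w k)" for j k
  proof (cases "j \<le> k")
    case True
    then have "t (w j) \<le> t (w k)" using strict_mono_less_eq[OF sm, of j k] by simp
    then show ?thesis using w(1)[of k] by simp
  next
    case False
    then have "t (w (Suc k)) \<le> t (w j)"
      using strict_mono_less_eq[OF sm, of "Suc k" j] by simp
    then show ?thesis using w(2)[of k] by simp
  qed
  then have "t ` range w - u ` range w = range (\<lambda>k. t (w k))" by auto
  moreover have "infinite (range (\<lambda>k. t (w k)))"
    using sm by (simp add: range_inj_infinite strict_mono_imp_inj_on)
  ultimately show False
    using ut[of "range w"] by (simp add: eq_mod_fin_def)
qed

subsection \<open>A nontrivial automorphism under the Continuum Hypothesis\<close>

text \<open>A pair \<open>(A, g)\<close> approximates the automorphism to be constructed: \<open>g\<close> is final, modulo finite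
  sets, on \<open>A\<close>, and undecided on the infinite complement of \<open>A\<close>, where it is provisionally
  the identity.\<close>

definition approximation_pair :: "nat set \<times> (nat \<Rightarrow> nat) \<Rightarrow> bool" where
  "approximation_pair p \<longleftrightarrow> infinite (- fst p) \<and> (\<forall>n. snd p (snd p n) = n) \<and>
     (\<forall>n. n \<notin> fst p \<longrightarrow> snd p n = n)"

definition extends_mod_fin :: "nat set \<times> (nat \<Rightarrow> nat) \<Rightarrow> nat set \<times> (nat \<Rightarrow> nat) \<Rightarrow> bool" where
  "extends_mod_fin p q \<longleftrightarrow> finite (fst p - fst q) \<and> finite {n \<in> fst p. snd p n \<noteq> snd q n}"

text \<open>Almost containing the complement of \<open>X\<close> is as good as almost containing
  \<open>X\<close>: the maps are bijections, so the image of either set fixes the image of the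
  other.\<close>

definition decides :: "nat set \<times> (nat \<Rightarrow> nat) \<Rightarrow> nat set \<Rightarrow> bool" where
  "decides p X \<longleftrightarrow> finite (X - fst p) \<or> finite (- X - fst p)"

section \<open>Approximation pairs and their coherence\<close>

lemma approximation_pairD:
  assumes "approximation_pair p"
  shows "snd p (snd p n) = n" "n \<notin> fst p \<Longrightarrow> snd p n = n" "infinite (- fst p)"
  using assms by (auto simp: approximation_pair_def)

lemma approximation_pair_bij: "approximation_pair p \<Longrightarrow> bij (snd p)"
  by (rule o_bij[of "snd p"]) (auto simp: approximation_pairD(1))

lemma approximation_pair_mem_iff:
  assumes "approximation_pair p"
  shows "snd p n \<in> fst p \<longleftrightarrow> n \<in> fst p"
  by (metis approximation_pairD(1,2)[OF assms])

lemma approximation_pair_image: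
  assumes "approximation_pair p"
  shows "snd p ` fst p = fst p"
proof
  show "snd p ` fst p \<subseteq> fst p" by (auto simp: approximation_pair_mem_iff[OF assms])
  show "fst p \<subseteq> snd p ` fst p"
  proof
    fix n assume "n \<in> fst p"
    then have "snd p n \<in> fst p" by (simp add: approximation_pair_mem_iff[OF assms])
    then have "snd p (snd p n) \<in> snd p ` fst p" by (rule imageI)
    then show "n \<in> snd p ` fst p" by (simp add: approximation_pairD(1)[OF assms])
  qed
qed

lemma extends_mod_fin_refl [simp]: "extends_mod_fin p p"
  by (simp add: extends_mod_fin_def)

lemma extends_mod_fin_trans:
  assumes "extends_mod_fin p q" "extends_mod_fin q r"
  shows "extends_mod_fin p r"
proof -
  have "fst p - fst r \<subseteq> (fst p - fst q) \<union> (fst q - fst r)"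
    "{n \<in> fst p. snd p n \<noteq> snd r n} \<subseteq>
      (fst p - fst q) \<union> {n \<in> fst p. snd p n \<noteq> snd q n} \<union> {n \<in> fst q. snd q n \<noteq> snd r n}"
    by auto
  then show ?thesis
    using assms unfolding extends_mod_fin_def by (meson finite_UnI finite_subset)
qed

lemma decides_mono:
  assumes "decides p X" "extends_mod_fin p q"
  shows "decides q X"
proof -
  have "X - fst q \<subseteq> (X - fst p) \<union> (fst p - fst q)" "- X - fst q \<subseteq> (- X - fst p) \<union> (fst p - fst q)"
    by auto
  then show ?thesis
    using assms unfolding decides_def extends_mod_fin_def by (meson finite_UnI finite_subset)
qed

text \<open>The involution preserves \<open>fst p\<close>, so finite remainders outside
  \<open>fst p\<close> go to finite remainders. This lets a single stage compute the automorphism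
  applied twice.\<close>

lemma decides_image:
  assumes p: "approximation_pair p" and "decides p X"
  shows "decides p (snd p ` X)"
proof -
  note b = approximation_pair_bij[OF p]
  have "snd p ` X - fst p = snd p ` (X - fst p)"
    using approximation_pair_image[OF p] bij_is_inj[OF b] by (metis image_set_diff)
  moreover have "- (snd p ` X) - fst p = snd p ` (- X - fst p)"
    using approximation_pair_image[OF p] bij_is_inj[OF b] bij_image_Compl_eq[OF b]
    by (metis image_set_diff)
  ultimately show ?thesis using assms(2) unfolding decides_def by auto
qed

lemma eq_mod_fin_Compl: "eq_mod_fin A B \<Longrightarrow> eq_mod_fin (- A) (- B)"
  by (metis cls_eq_iff uminus_pfin.abs_eq)

lemma eq_mod_fin_image:
  assumes "eq_mod_fin X Y"
  shows "eq_mod_fin (g ` X) (g ` Y)"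
proof -
  have "finite (g ` ((X - Y) \<union> (Y - X)))" using assms by (simp add: eq_mod_fin_def)
  then show ?thesis unfolding eq_mod_fin_def by (rule rev_finite_subset) blast
qed

text \<open>If \<open>X\<close> is almost inside \<open>fst p\<close>, the two maps differ at only
  finitely many points of \<open>X\<close>; otherwise the same holds for \<open>- X\<close>, and
  bijectivity transfers the conclusion to \<open>X\<close>.\<close>

lemma decides_image_eq_mod_fin:
  assumes p: "approximation_pair p" and q: "approximation_pair q"
    and pq: "extends_mod_fin p q" and X: "decides p X"
  shows "eq_mod_fin (snd p ` X) (snd q ` X)"
proof -
  have *: "eq_mod_fin (snd p ` Y) (snd q ` Y)" if Y: "finite (Y - fst p)" for Y
  proof -
    let ?D = "(Y - fst p) \<union> {n \<in> fst p. snd p n \<noteq> snd q n}"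
    have "finite ?D" using pq Y by (simp add: extends_mod_fin_def)
    then have "finite (snd p ` ?D \<union> snd q ` ?D)" by blast
    moreover have "(snd p ` Y - snd q ` Y) \<union> (snd q ` Y - snd p ` Y) \<subseteq> snd p ` ?D \<union> snd q ` ?D"
    proof
      fix m assume "m \<in> (snd p ` Y - snd q ` Y) \<union> (snd q ` Y - snd p ` Y)"
      then obtain n where n: "n \<in> Y" "m = snd p n \<or> m = snd q n" "snd p n \<noteq> snd q n"
        by (elim UnE DiffE imageE; metis image_eqI)
      then have "n \<in> ?D" by blast
      with n(2) show "m \<in> snd p ` ?D \<union> snd q ` ?D" by blast
    qed
    ultimately show ?thesis unfolding eq_mod_fin_def by (rule rev_finite_subset)
  qed
  from X consider "finite (X - fst p)" | "finite (- X - fst p)" by (auto simp: decides_def)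
  then show ?thesis
  proof cases
    case 1 then show ?thesis by (rule *)
  next
    case 2
    then have "eq_mod_fin (- snd p ` (- X)) (- snd q ` (- X))"
      by (intro eq_mod_fin_Compl *)
    then show ?thesis
      by (simp add: bij_image_Compl_eq approximation_pair_bij p q)
  qed
qed

section \<open>Upper bounds of countable chains\<close>

lemma finite_chain_upper_bound:
  assumes "finite I" "I \<noteq> {}" and ap: "\<And>i. i \<in> I \<Longrightarrow> approximation_pair (c i)"
    and chain: "\<And>i j. i \<in> I \<Longrightarrow> j \<in> I \<Longrightarrow> extends_mod_fin (c i) (c j) \<or> extends_mod_fin (c j) (c i)"
  shows "\<exists>j\<in>I. \<forall>i\<in>I. extends_mod_fin (c i) (c j)"
  using assms(1,2,4)
proof (induction rule: finite_ne_induct)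
  case (insert x F)
  then obtain j where j: "j \<in> F" "\<forall>i\<in>F. extends_mod_fin (c i) (c j)" by blast
  show ?case
  proof (cases "extends_mod_fin (c x) (c j)")
    case False
    then have "extends_mod_fin (c j) (c x)" using insert.prems j(1) by blast
    then show ?thesis using j(2) by (blast intro: extends_mod_fin_trans extends_mod_fin_refl)
  qed (use j in blast)
qed simp

text \<open>Limit step of the tower. After a finite set is discarded from each domain, the
  involutions agree exactly where they overlap and can be glued; a diagonal sequence avoiding all
  trimmed domains keeps the complement of the union infinite.\<close>

lemma countable_chain_upper_bound:
  assumes "countable C" and ap: "\<And>p. p \<in> C \<Longrightarrow> approximation_pair p"
    and chain: "\<And>p q. p \<in> C \<Longrightarrow> q \<in> C \<Longrightarrow> extends_mod_fin p q \<or> extends_mod_fin q p"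
  shows "\<exists>q. approximation_pair q \<and> (\<forall>p\<in>C. extends_mod_fin p q)"
proof (cases "C = {}")
  case True
  have "approximation_pair ({}, id)" by (simp add: approximation_pair_def)
  with True show ?thesis by blast
next
  case False
  define A g where "A n = fst (from_nat_into C n)" and "g n = snd (from_nat_into C n)" for n
  have C: "(A n, g n) \<in> C" for n
    using False by (simp add: A_def g_def from_nat_into)
  have onto: "\<exists>n. p = (A n, g n)" if "p \<in> C" for p
    by (metis A_def g_def assms(1) from_nat_into_surj prod.collapse that)
  note apn = ap[OF C, unfolded approximation_pair_def, simplified]
  have inv: "g n (g n k) = k" and off: "k \<notin> A n \<Longrightarrow> g n k = k" for n k
    using apn by blast+
  have gA: "g n k \<in> A n \<longleftrightarrow> k \<in> A n" for n k
    by (metis inv off)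
  \<comment> \<open>One of the first \<open>n + 1\<close> sets almost contains the others and is
    coinfinite, so their union misses arbitrarily large numbers.\<close>
  have "\<exists>x. x \<ge> n \<and> x \<notin> (\<Union>i\<le>n. A i)" for n
  proof -
    obtain j where j: "j \<le> n" "\<And>i. i \<le> n \<Longrightarrow> extends_mod_fin (A i, g i) (A j, g j)"
      using finite_chain_upper_bound[of "{..n}" "\<lambda>i. (A i, g i)"] ap chain C by auto
    have "finite ({..<n} \<union> (\<Union>i\<le>n. A i - A j))"
      using j(2) by (intro finite_UnI finite_UN_I) (auto simp: extends_mod_fin_def)
    then have "infinite (- A j - ({..<n} \<union> (\<Union>i\<le>n. A i - A j)))"
      using apn by (intro Diff_infinite_finite) auto
    then obtain x where "x \<in> - A j - ({..<n} \<union> (\<Union>i\<le>n. A i - A j))"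
      by (metis all_not_in_conv finite.emptyI)
    then show ?thesis by (intro exI[of _ x]) auto
  qed
  then obtain x where x: "\<And>n. x n \<ge> n" "\<And>n i. i \<le> n \<Longrightarrow> x n \<notin> A i"
    by (metis UN_I atMost_iff)
  \<comment> \<open>\<open>E m\<close> collects the diagonal points of index below \<open>m\<close>,
    which may lie in \<open>A m\<close> (the later ones do not), and the disagreements with earlier
    maps. Removing also the image of \<open>E m\<close> under \<open>g m\<close> makes
    \<open>B m\<close> closed under \<open>g m\<close>.\<close>
  define E where "E m = x ` {..<m} \<union> (\<Union>k<m. {n \<in> A k \<inter> A m. g k n \<noteq> g m n})" for m
  define B where "B m = A m - (E m \<union> g m ` E m)" for m
  have "finite {n \<in> A k \<inter> A m. g k n \<noteq> g m n}" for k m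
  proof (cases "extends_mod_fin (A k, g k) (A m, g m)")
    case True
    then have "finite {n \<in> A k. g k n \<noteq> g m n}" by (simp add: extends_mod_fin_def)
    then show ?thesis by (rule rev_finite_subset) auto
  next
    case False
    then have "extends_mod_fin (A m, g m) (A k, g k)"
      using chain[OF C C] by blast
    then have "finite {n \<in> A m. g m n \<noteq> g k n}"
      by (simp add: extends_mod_fin_def)
    then show ?thesis by (rule rev_finite_subset) auto
  qed
  then have finE: "finite (E m)" for m by (simp add: E_def)
  have gE: "g m n \<in> E m \<union> g m ` E m \<longleftrightarrow> n \<in> E m \<union> g m ` E m" for m n
    by (metis (no_types, opaque_lifting) UnE UnI1 UnI2 image_iff inv)
  have gB: "g m n \<in> B m \<longleftrightarrow> n \<in> B m" for m n
    using gA[of m n] gE[of m n] by (simp add: B_def)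
  have agree: "g k n = g m n" if "n \<in> B k" "n \<in> B m" for k m n
  proof (cases k m rule: linorder_cases)
    case less then show ?thesis using that by (auto simp: B_def E_def)
  next
    case greater then show ?thesis using that by (fastforce simp: B_def E_def)
  qed simp
  \<comment> \<open>By \<open>agree\<close> the choice of \<open>m\<close> in \<open>SOME\<close>
    does not affect \<open>h\<close>; off \<open>D\<close> the default is the identity, as an
    approximation pair demands.\<close>
  define D h where "D = (\<Union>m. B m)"
    and "h n = (if n \<in> D then g (SOME m. n \<in> B m) n else n)" for n
  have h: "h n = g m n" if "n \<in> B m" for m n
  proof -
    have "n \<in> B (SOME m. n \<in> B m)" using that by (rule someI)
    with that show ?thesis unfolding h_def D_def by (auto intro: agree)
  qed
  have "h (h n) = n" for n
  proof (cases "n \<in> D")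
    case True
    then obtain m where m: "n \<in> B m" by (auto simp: D_def)
    then have "h (g m n) = g m (g m n)" by (intro h) (simp add: gB)
    with m show ?thesis by (simp add: h inv)
  qed (simp add: h_def)
  moreover have "infinite (- D)"
  proof -
    have "x n \<notin> B m" for m n
      using x(2)[of m n] by (cases "m \<le> n") (auto simp: B_def E_def)
    then have "range x \<subseteq> - D" by (auto simp: D_def)
    moreover have "infinite (range x)"
      unfolding infinite_nat_iff_unbounded_le using x(1) by auto
    ultimately show ?thesis by (metis finite_subset)
  qed
  ultimately have "approximation_pair (D, h)"
    by (simp add: approximation_pair_def h_def)
  moreover have "extends_mod_fin p (D, h)" if "p \<in> C" for p
  proof -
    obtain m where p: "p = (A m, g m)" using onto \<open>p \<in> C\<close> by blast
    have "n \<in> E m \<union> g m ` E m" if "n \<in> A m" "n \<notin> D \<or> g m n \<noteq> h n" for n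
    proof (rule ccontr)
      assume "n \<notin> E m \<union> g m ` E m"
      with that have "n \<in> B m" by (simp add: B_def)
      with that h[OF this] show False by (auto simp: D_def)
    qed
    then have "A m - D \<subseteq> E m \<union> g m ` E m" "{n \<in> A m. g m n \<noteq> h n} \<subseteq> E m \<union> g m ` E m"
      by blast+
    moreover have "finite (E m \<union> g m ` E m)" using finE by blast
    ultimately show ?thesis unfolding p extends_mod_fin_def fst_conv snd_conv
      by (meson finite_subset)
  qed
  ultimately show ?thesis by blast
qed

section \<open>One-step extensions\<close>

text \<open>If adding \<open>X\<close> would leave only finitely many free points, then
  \<open>- X\<close> is almost contained in \<open>fst p\<close> and \<open>p\<close> already
  decides \<open>X\<close>. Otherwise \<open>X\<close> is added to the domain and the map is left
  unchanged.\<close>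

lemma extension_deciding:
  assumes p: "approximation_pair p"
  shows "\<exists>q. approximation_pair q \<and> extends_mod_fin p q \<and> decides q X"
proof (cases "finite (- (fst p \<union> X))")
  case True
  then have "decides p X" by (simp add: decides_def Diff_eq Int_commute)
  with p show ?thesis by (blast intro: extends_mod_fin_refl)
next
  case False
  then have "approximation_pair (fst p \<union> X, snd p)"
    using p by (simp add: approximation_pair_def)
  moreover have "finite (fst p - (fst p \<union> X))" "finite (X - (fst p \<union> X))"
    by (rule finite_subset[of _ "{}"]; blast)+
  then have "extends_mod_fin p (fst p \<union> X, snd p)" "decides (fst p \<union> X, snd p) X"
    by (simp_all add: extends_mod_fin_def decides_def)
  ultimately show ?thesis by blast
qed

text \<open>Both the identity and an involution moving \<open>E\<close> off itself extend the given approximation;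
  a function \<open>t\<close> can induce at most one of the two modulo finite sets.\<close>

lemma extension_avoiding:
  fixes t :: "nat \<Rightarrow> nat"
  assumes p: "approximation_pair p"
  shows "\<exists>q E. approximation_pair q \<and> extends_mod_fin p q \<and> decides q E \<and>
    \<not> eq_mod_fin (snd q ` E) (t ` E)"
proof -
  define A g where "A = fst p" and "g = snd p"
  have inv: "g (g n) = n" and off: "n \<notin> A \<Longrightarrow> g n = n" and inf: "infinite (- A)" for n
    using approximation_pairD[OF p] by (auto simp: A_def g_def)
  have gA: "g n \<in> A \<longleftrightarrow> n \<in> A" for n by (metis inv off)
  obtain c :: "nat \<Rightarrow> nat" where c: "inj c" "range c \<subseteq> - A"
    using infinite_countable_subset[OF inf] by blast
  have cA: "c k \<notin> A" for k using c(2) by auto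
  \<comment> \<open>Three disjoint infinite pieces of the complement of \<open>A\<close>:
    \<open>R 0\<close> and \<open>R 1\<close> will be either fixed or exchanged, and
    \<open>R 2\<close> stays outside the new domain.\<close>
  define R where "R i = range (\<lambda>k. c (3 * k + i))" for i :: nat
  have infR: "infinite (R i)" for i
    unfolding R_def using c(1) by (intro range_inj_infinite injI) (auto dest: injD[OF c(1)])
  have disj: "R i \<inter> R j = {}" if "i < 3" "j < 3" "i \<noteq> j" for i j
  proof -
    have "3 * k + i \<noteq> 3 * l + j" for k l using that by presburger
    then show ?thesis using c(1) by (auto simp: R_def inj_eq)
  qed
  have RA: "R i \<inter> A = {}" for i using cA by (auto simp: R_def)
  define B where "B = A \<union> R 0 \<union> R 1"
  \<comment> \<open>\<open>s\<close> exchanges \<open>3 * k\<close> and \<open>3 * k + 1\<close> and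
    fixes \<open>3 * k + 2\<close>.\<close>
  define s where "s k = (if k mod 3 = 0 then k + 1 else if k mod 3 = 1 then k - 1 else k)" for k :: nat
  define h where "h n = (if n \<in> range c then c (s (inv_into UNIV c n)) else g n)" for n
  have hc: "h (c k) = c (s k)" for k using c(1) by (simp add: h_def)
  have ss: "s (s k) = k" for k
  proof -
    have "k mod 3 < 3" by simp
    then consider "k mod 3 = 0" | "k mod 3 = 1" | "k mod 3 = 2" by linarith
    then show ?thesis
    proof cases
      case 1
      then have "(k + 1) mod 3 = 1" by presburger
      with 1 show ?thesis by (simp add: s_def)
    next
      case 2
      then have "(k - 1) mod 3 = 0" "k \<ge> 1" by presburger+
      with 2 show ?thesis by (simp add: s_def)
    qed (simp add: s_def)
  qed
  have infB: "infinite (- B)"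
  proof -
    have "R 2 \<subseteq> - B" using disj[of 2 0] disj[of 2 1] RA[of 2] by (auto simp: B_def)
    then show ?thesis using infR[of 2] finite_subset by blast
  qed
  have "approximation_pair (B, g)"
    using infB inv off by (auto simp: approximation_pair_def B_def)
  moreover have "approximation_pair (B, h)"
  proof -
    have "h (h n) = n" for n
    proof (cases "n \<in> range c")
      case True then show ?thesis by (auto simp: hc ss)
    next
      case False
      then have "g n \<notin> range c" using off gA cA by (metis imageE)
      then show ?thesis using False by (simp add: h_def inv)
    qed
    moreover have "h n = n" if "n \<notin> B" for n
    proof (cases "n \<in> range c")
      case True
      then obtain k where k: "n = c k" by blast
      have "k mod 3 \<noteq> 0"
      proof
        assume "k mod 3 = 0"
        then have "k = 3 * (k div 3) + 0" by presburger
        then have "n \<in> R 0" unfolding R_def k by (metis rangeI)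
        with that show False by (simp add: B_def)
      qed
      moreover have "k mod 3 \<noteq> 1"
      proof
        assume "k mod 3 = 1"
        then have "k = 3 * (k div 3) + 1" by presburger
        then have "n \<in> R 1" unfolding R_def k by (metis rangeI)
        with that show False by (simp add: B_def)
      qed
      ultimately show ?thesis by (simp add: k hc s_def)
    qed (use that off in \<open>simp add: h_def B_def\<close>)
    ultimately show ?thesis using infB by (simp add: approximation_pair_def)
  qed
  moreover have "extends_mod_fin p (B, g)" "extends_mod_fin p (B, h)"
  proof -
    have "finite (A - B)"
      by (rule finite_subset[of _ "{}"]) (auto simp: B_def)
    moreover have "finite {n \<in> A. g n \<noteq> h n}"
      by (rule finite_subset[of _ "{}"]) (use cA in \<open>auto simp: h_def\<close>)
    ultimately show "extends_mod_fin p (B, g)" "extends_mod_fin p (B, h)"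
      by (simp_all add: extends_mod_fin_def A_def[symmetric] g_def[symmetric])
  qed
  moreover have "decides (B, i) (R 0)" for i
  proof -
    have "finite (R 0 - B)"
      by (rule finite_subset[of _ "{}"]) (auto simp: B_def)
    then show ?thesis by (simp add: decides_def)
  qed
  \<comment> \<open>The set \<open>E\<close> is \<open>R 0\<close>: \<open>g\<close> maps it onto
    itself and \<open>h\<close> maps it onto \<open>R 1\<close>, and these disjoint infinite sets
    cannot both be almost equal to the same image.\<close>
  moreover have "\<not> eq_mod_fin (g ` R 0) (t ` R 0) \<or> \<not> eq_mod_fin (h ` R 0) (t ` R 0)"
  proof (rule ccontr)
    have "g n = n" if "n \<in> R 0" for n using that RA[of 0] off by blast
    then have "g ` R 0 = R 0" by force
    moreover have "h ` R 0 = R 1"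
      by (simp add: R_def image_image hc s_def)
    moreover assume "\<not> ?thesis"
    ultimately have "cls (R 0) = cls (R 1)" by (simp flip: cls_eq_iff)
    then have "finite (R 0 - R 1)" by (simp add: cls_eq_iff eq_mod_fin_def)
    moreover have "R 0 - R 1 = R 0" using disj[of 0 1] by auto
    ultimately show False using infR[of 0] by simp
  qed
  ultimately show ?thesis by (metis fst_conv snd_conv)
qed

section \<open>Enumerations of length omega_1\<close>

text \<open>In the cardinal order of the reals each proper initial segment has smaller cardinality
  than the reals, so under the hypothesis it cannot be uncountable.\<close>

lemma continuum_hypothesis_wellorder:
  includes cardinal_syntax
  assumes continuum_hypothesis
  shows "\<exists>r :: (real \<times> real) set. wf r \<and> total r \<and> (\<forall>x. countable {y. (y, x) \<in> r})"
proof -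
  define r where "r = |UNIV :: real set|"
  have co: "Card_order r" unfolding r_def by (rule card_of_Card_order)
  have Field: "Field r = UNIV" by (simp add: r_def Field_card_of)
  have "Well_order r" unfolding r_def by (rule card_of_Well_order)
  then have wo: "well_order_on UNIV r" unfolding Field .
  have "wf (r - Id)" "total_on UNIV r"
    using wo by (auto simp: order_on_defs)
  moreover have "countable {y. (y, x) \<in> r - Id}" for x
  proof (rule ccontr)
    let ?S = "{y. (y, x) \<in> r - Id}"
    assume "uncountable ?S"
    then have "?S \<approx> (UNIV :: real set)" using assms by (simp add: continuum_hypothesis_def)
    then have "|?S| =o r"
      by (simp add: r_def eqpoll_def card_of_ordIso)
    moreover have "|?S| <o r"
    proof -
      have "?S = underS r x" by (auto simp: underS_def)
      then show ?thesis using card_of_underS[OF co, of x] Field by simp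
    qed
    ultimately show False by (simp add: not_ordLess_ordIso)
  qed
  moreover have "total (r - Id)" using \<open>total_on UNIV r\<close> by simp
  ultimately show ?thesis by blast
qed

text \<open>The reals are equinumerous with the sets of naturals, and a function is recovered from
  its graph coded by \<open>prod_encode\<close>. Thus the reals can index all tasks of the
  recursion.\<close>

lemma ex_surj_real_nat_fun: "\<exists>e :: real \<Rightarrow> nat \<Rightarrow> nat. surj e"
proof -
  have "(UNIV :: real set) \<approx> (UNIV :: nat set set)"
    using nat_sets_eqpoll_reals by (rule eqpoll_sym)
  then obtain b :: "real \<Rightarrow> nat set" where b: "bij b"
    unfolding eqpoll_def by blast
  define e where "e x n = (LEAST m. prod_encode (n, m) \<in> b x)" for x n
  have "\<exists>x. e x = t" for t
  proof -
    obtain x where "b x = (\<lambda>n. prod_encode (n, t n)) ` UNIV"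
      using b by (metis bij_pointE)
    then have "e x = t"
      by (auto simp: e_def fun_eq_iff prod_encode_eq image_iff intro!: Least_equality)
    then show ?thesis by blast
  qed
  then show ?thesis by (metis surjI surj_def)
qed

section \<open>The tower of approximations\<close>

lemma continuum_hypothesis_tower:
  assumes continuum_hypothesis
  shows "\<exists>f :: real \<Rightarrow> nat set \<times> (nat \<Rightarrow> nat).
    (\<forall>i. approximation_pair (f i)) \<and>
    (\<forall>i j. extends_mod_fin (f i) (f j) \<or> extends_mod_fin (f j) (f i)) \<and>
    (\<forall>X. \<exists>i. decides (f i) X) \<and>
    (\<forall>t. \<exists>i E. decides (f i) E \<and> \<not> eq_mod_fin (snd (f i) ` E) (t ` E))"
proof -
  obtain r :: "(real \<times> real) set" where r: "wf r" "total r"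
    and cnt: "\<And>x. countable {y. (y, x) \<in> r}"
    using continuum_hypothesis_wellorder[OF assms] by blast
  obtain e :: "real \<Rightarrow> nat \<Rightarrow> nat" where e: "surj e" using ex_surj_real_nat_fun by blast
  \<comment> \<open>Each real \<open>x\<close> carries two tasks: the zero set of \<open>e x\<close>
    runs through all sets to be decided, and \<open>e x\<close> itself through all functions that
    might induce the automorphism.\<close>
  define P where "P f x q \<longleftrightarrow> approximation_pair q \<and> (\<forall>y. (y, x) \<in> r \<longrightarrow> extends_mod_fin (f y) q) \<and>
      decides q {n. e x n = 0} \<and> (\<exists>E. decides q E \<and> \<not> eq_mod_fin (snd q ` E) (e x ` E))"
    for f :: "real \<Rightarrow> nat set \<times> (nat \<Rightarrow> nat)" and x q
  have "\<exists>f. \<forall>x. P f x (f x)"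
  \<comment> \<open>The first goal holds because \<open>P f x\<close> looks at \<open>f\<close> only
    below \<open>x\<close>.\<close>
  proof (rule dependent_wf_choice[OF r(1)])
    fix f g :: "real \<Rightarrow> nat set \<times> (nat \<Rightarrow> nat)" and x q
    assume "\<And>z. (z, x) \<in> r \<Longrightarrow> f z = g z"
    then show "P f x q = P g x q" by (simp add: P_def cong: conj_cong)
  next
    fix x and f :: "real \<Rightarrow> nat set \<times> (nat \<Rightarrow> nat)"
    assume IH: "P f y (f y)" if "(y, x) \<in> r" for y
    define C where "C = f ` {y. (y, x) \<in> r}"
    have "countable C" using cnt by (simp add: C_def)
    moreover have "approximation_pair p" if "p \<in> C" for p
      using that IH by (auto simp: C_def P_def)
    moreover have "extends_mod_fin p q \<or> extends_mod_fin q p" if "p \<in> C" "q \<in> C" for p q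
    proof -
      obtain y z where yz: "p = f y" "(y, x) \<in> r" "q = f z" "(z, x) \<in> r"
        using \<open>p \<in> C\<close> \<open>q \<in> C\<close> unfolding C_def by blast
      consider "y = z" | "(y, z) \<in> r" | "(z, y) \<in> r"
        using r(2) unfolding total_on_def by blast
      then show ?thesis using IH yz by cases (auto simp: P_def)
    qed
    ultimately obtain p where p: "approximation_pair p" "\<And>c. c \<in> C \<Longrightarrow> extends_mod_fin c p"
      using countable_chain_upper_bound[of C] by blast
    \<comment> \<open>The function is defeated first. As \<open>p'\<close> decides \<open>E\<close>,
      passing on to \<open>q\<close> changes the image of \<open>E\<close> only by a finite set, so
      the defeat persists.\<close>
    obtain p' E where p': "approximation_pair p'" "extends_mod_fin p p'" "decides p' E"
      "\<not> eq_mod_fin (snd p' ` E) (e x ` E)"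
      using extension_avoiding[OF p(1)] by blast
    obtain q where q: "approximation_pair q" "extends_mod_fin p' q" "decides q {n. e x n = 0}"
      using extension_deciding[OF p'(1)] by blast
    have "\<not> eq_mod_fin (snd q ` E) (e x ` E)"
      using decides_image_eq_mod_fin[OF p'(1) q(1,2) p'(3)] p'(4) by (simp flip: cls_eq_iff)
    moreover have "decides q E" using decides_mono p'(3) q(2) by blast
    moreover have "extends_mod_fin (f y) q" if "(y, x) \<in> r" for y
      using that p(2) p'(2) q(2) extends_mod_fin_trans unfolding C_def by blast
    ultimately show "\<exists>q. P f x q" using q unfolding P_def by blast
  qed
  then obtain f where f: "P f x (f x)" for x by blast
  have "extends_mod_fin (f i) (f j) \<or> extends_mod_fin (f j) (f i)" for i j
  proof -
    consider "i = j" | "(i, j) \<in> r" | "(j, i) \<in> r"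
      using r(2) unfolding total_on_def by blast
    then show ?thesis using f by cases (auto simp: P_def)
  qed
  moreover have "\<exists>i. decides (f i) X" for X
  proof -
    obtain i where i: "e i = (\<lambda>n. if n \<in> X then 0 else 1)" using e by (metis surjD)
    then have "{n. e i n = 0} = X" by auto
    then show ?thesis using f[of i] by (auto simp: P_def)
  qed
  moreover have "\<exists>i E. decides (f i) E \<and> \<not> eq_mod_fin (snd (f i) ` E) (t ` E)" for t
  proof -
    obtain i where "e i = t" using e by (metis surjD)
    then show ?thesis using f[of i] by (auto simp: P_def)
  qed
  moreover have "approximation_pair (f i)" for i using f by (simp add: P_def)
  ultimately show ?thesis by blast
qed

section \<open>Gluing the tower into an automorphism\<close>

text \<open>The class of \<open>X\<close> is sent to the class of its image under any stage deciding
  \<open>X\<close>; coherence makes this independent of the stage. Two sets are always decided by a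
  common stage, so the Boolean laws reduce to those of images under one bijection.\<close>

lemma continuum_hypothesis_nontrivial_automorphism:
  assumes continuum_hypothesis
  shows "\<exists>\<phi>. nontrivial_automorphism \<phi>"
proof -
  obtain f :: "real \<Rightarrow> nat set \<times> (nat \<Rightarrow> nat)"
    where ap: "\<And>i. approximation_pair (f i)"
      and chain: "\<And>i j. extends_mod_fin (f i) (f j) \<or> extends_mod_fin (f j) (f i)"
      and dec: "\<And>X. \<exists>i. decides (f i) X"
      and kill: "\<And>t. \<exists>i E. decides (f i) E \<and> \<not> eq_mod_fin (snd (f i) ` E) (t ` E)"
    using continuum_hypothesis_tower[OF assms] by blast
  \<comment> \<open>Representative and stage are arbitrary choices here; the fact also named
    \<open>\<phi>\<close> shows that neither matters.\<close>
  define \<phi> where "\<phi> x = cls (snd (f (SOME i. decides (f i) (rep_pfin x))) ` rep_pfin x)" for x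
  have dec_cong: "decides p Y" if "eq_mod_fin X Y" "decides p X" for p X Y
  proof -
    have fin: "finite ((X - Y) \<union> (Y - X))" using that(1) by (simp add: eq_mod_fin_def)
    have "Y - fst p \<subseteq> (X - fst p) \<union> ((X - Y) \<union> (Y - X))"
      "- Y - fst p \<subseteq> (- X - fst p) \<union> ((X - Y) \<union> (Y - X))" by auto
    then show ?thesis using that(2) fin unfolding decides_def by (meson finite_UnI finite_subset)
  qed
  have agree: "eq_mod_fin (snd (f i) ` X) (snd (f j) ` X)"
    if "decides (f i) X" "decides (f j) X" for i j X
    using chain[of i j] decides_image_eq_mod_fin[OF ap ap] that
    by (auto simp flip: cls_eq_iff)
  have \<phi>: "\<phi> (cls X) = cls (snd (f i) ` X)" if "decides (f i) X" for i X
  proof -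
    let ?Y = "rep_pfin (cls X)"
    let ?j = "SOME i. decides (f i) ?Y"
    have "cls ?Y = cls X" by simp
    then have XY: "eq_mod_fin X ?Y" by (simp flip: cls_eq_iff)
    then have "decides (f i) ?Y" using dec_cong that by blast
    then have "eq_mod_fin (snd (f ?j) ` ?Y) (snd (f i) ` ?Y)"
      by (intro agree) (rule someI)
    moreover have "eq_mod_fin (snd (f i) ` X) (snd (f i) ` ?Y)"
      using XY by (rule eq_mod_fin_image)
    ultimately show ?thesis by (simp add: \<phi>_def flip: cls_eq_iff)
  qed
  have common: "\<exists>i. decides (f i) X \<and> decides (f i) Y" for X Y
    using dec[of X] dec[of Y] chain decides_mono by metis
  have inter: "decides p (X \<inter> Y)" if "decides p X" "decides p Y" for p X Y
  proof -
    have "X \<inter> Y - fst p \<subseteq> X - fst p" "X \<inter> Y - fst p \<subseteq> Y - fst p"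
      "- (X \<inter> Y) - fst p = (- X - fst p) \<union> (- Y - fst p)" by auto
    with that show ?thesis unfolding decides_def by (metis finite_UnI finite_subset)
  qed
  have compl: "decides p (- X)" if "decides p X" for p X
    using that by (auto simp: decides_def)
  have bij: "bij (snd (f i))" for i by (rule approximation_pair_bij[OF ap])
  have \<phi>_compl: "\<phi> (- x) = - \<phi> x" for x
  proof -
    obtain X where x: "x = cls X" using cls_cases .
    obtain i where i: "decides (f i) X" using dec by blast
    have "\<phi> (- x) = cls (snd (f i) ` (- X))"
      unfolding x uminus_pfin.abs_eq by (rule \<phi>[OF compl[OF i]])
    also have "\<dots> = - \<phi> x"
      by (simp add: x \<phi>[OF i] bij_image_Compl_eq[OF bij] uminus_pfin.abs_eq)
    finally show ?thesis .
  qed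
  have \<phi>_inf: "\<phi> (inf x y) = inf (\<phi> x) (\<phi> y)" for x y
  proof -
    obtain X Y where xy: "x = cls X" "y = cls Y" using cls_cases by metis
    obtain i where i: "decides (f i) X" "decides (f i) Y" using common by blast
    have "\<phi> (inf x y) = cls (snd (f i) ` (X \<inter> Y))"
      unfolding xy inf_pfin.abs_eq by (rule \<phi>[OF inter[OF i]])
    also have "\<dots> = inf (\<phi> x) (\<phi> y)"
      by (simp add: xy \<phi>[OF i(1)] \<phi>[OF i(2)] image_Int[OF bij_is_inj[OF bij]] inf_pfin.abs_eq)
    finally show ?thesis .
  qed
  have \<phi>_sup: "\<phi> (sup x y) = sup (\<phi> x) (\<phi> y)" for x y
    using \<phi>_compl[of "inf (- x) (- y)"] by (simp add: \<phi>_inf \<phi>_compl)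
  \<comment> \<open>Keeping \<open>- bot\<close> from being rewritten to \<open>top\<close> lets
    \<open>\<phi>_compl\<close> turn the right side into the meet of an element with its
    complement.\<close>
  have \<phi>_bot: "\<phi> bot = bot"
    using \<phi>_inf[of bot "- bot"] by (simp add: \<phi>_compl del: compl_bot_eq)
  have \<phi>_top: "\<phi> top = top"
    using \<phi>_compl[of bot] by (simp add: \<phi>_bot)
  have "\<phi> (\<phi> x) = x" for x
  proof -
    obtain X where x: "x = cls X" using cls_cases .
    obtain i where i: "decides (f i) X" using dec by blast
    have "\<phi> (\<phi> x) = cls (snd (f i) ` snd (f i) ` X)"
      unfolding x \<phi>[OF i] by (rule \<phi>[OF decides_image[OF ap i]])
    then show ?thesis by (simp add: x image_image approximation_pairD(1)[OF ap])
  qed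
  then have "bij \<phi>" by (intro o_bij[of \<phi>]) auto
  then have iso: "boolean_iso \<phi>"
    by (simp add: boolean_iso_def \<phi>_bot \<phi>_top \<phi>_inf \<phi>_sup \<phi>_compl)
  moreover have "\<not> trivial_automorphism \<phi>"
  proof
    assume "trivial_automorphism \<phi>"
    then obtain t where t: "\<phi> (cls A) = cls (t ` A)" for A
      by (auto simp: trivial_automorphism_def)
    obtain i E where "decides (f i) E" "\<not> eq_mod_fin (snd (f i) ` E) (t ` E)"
      using kill by blast
    with t[of E] \<phi>[of i E] show False by (simp add: cls_eq_iff)
  qed
  ultimately show ?thesis unfolding nontrivial_automorphism_def by blast
qed

theorem theorem12p10:
  "(conjugate_systems shift (inv shift) \<longrightarrow>
      (\<exists>\<zeta>. nontrivial_automorphism \<zeta> \<and> conjugate_systems shift \<zeta>)) \<and>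
   (continuum_hypothesis \<longrightarrow>
      (\<exists>\<zeta>. nontrivial_automorphism \<zeta> \<and> conjugate_in_aut_group shift \<zeta>))"
proof (intro conjI impI)
  assume "conjugate_systems shift (inv shift)"
  \<comment> \<open>The isomorphism supplied by the conjugacy is itself the nontrivial automorphism
    needed for the splitting argument.\<close>
  then obtain \<phi> where "nontrivial_automorphism \<phi>"
    using shift_reversal_nontrivial by (auto simp: conjugate_systems_def)
  then show "\<exists>\<zeta>. nontrivial_automorphism \<zeta> \<and> conjugate_systems shift \<zeta>"
    using shift_conjugate_nontrivial conjugate_in_aut_group_imp_conjugate_systems by blast
next
  assume continuum_hypothesis
  then show "\<exists>\<zeta>. nontrivial_automorphism \<zeta> \<and> conjugate_in_aut_group shift \<zeta>"
    using continuum_hypothesis_nontrivial_automorphism shift_conjugate_nontrivial by blast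
qed

end
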